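(* In a dynamic ring system $(\mathcal{R},\mathcal{A})$, strict Gathering is unsolvable; this holds regardless of chirality, cross detection, and knowledge of $k$ and $n$.
   Context: Dynamic ring. $\mathcal{R}=(v_0,\dots,v_{n-1})$ is a ring of $n$ anonymous nodes; $v_i$ is joined to $v_{i-1}$ and $v_{i+1}$ (indices modulo $n$) through two distinctly labeled ports $q_{i-}$, $q_{i+}$; the labeling is arbitrary and need not give a globally consistent orientation. Each port has an incoming and an outgoing buffer. Time proceeds in synchronous rounds; in each round an adversarial scheduler, not restricted by any fairness assumption, chooses which edge (at most one) is missing (1-interval connectivity). Agents. $\mathcal{A}$ is a set of $k$ anonymous agents, each with its own memory and computational capability, all executing the same deterministic protocol. They start at distinct nodes, called homebases; homebases are identically marked, so an agent can tell whether its current node is a homebase. Several agents may be in the same node; an agent sees how many other agents are in its node and where (at the node, in which incoming or outgoing buffer). Agents have no explicit communication. Each agent has a private orientation of the ring, consistent over all nodes, designating at each node one port as left and the other as right. There is chirality if all agents agree on the orientation. There is cross detection if, whenever agents move in opposite directions on the same edge in the same round, the involved agents detect this event. Rounds. In each round each agent, based on the number of agents at its node and in the buffers, its memory and its state, chooses a direction in $\{left,right,nil\}$. With $nil$ it places itself at the node. Otherwise it moves to the outgoing buffer of the chosen port; if the edge is present, it arrives in the incoming buffer of the corresponding port of the neighbouring node in the next round; if the edge is missing it stays in the outgoing buffer. There is an initial state and a terminal state. Strict Gathering. Gathering is achieved in a round if all agents are on the same node or on two neighbouring nodes; in the first case (all agents on the same node) gathering is strict. An algorithm solves strict Gathering if,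 for every adversarial schedule, within finite time all agents are in the terminal state, are all on the same node, and are aware that this has been achieved. *)

theory Defs
  imports Main
begin

section \<open>Dynamic rings and agents\<close>

text \<open>
  The nodes are \<open>0, \<dots>, n - 1\<close>. The ports \<open>q\<^sub>i\<^sub>-\<close> and \<open>q\<^sub>i\<^sub>+\<close> of node \<open>i\<close> are
  the pairs of \<open>i\<close> with the sides \<open>Prev\<close> and \<open>Next\<close>; edge number \<open>i\<close> joins \<open>i\<close> to
  \<open>(i + 1) mod n\<close>. The names of nodes, sides, edges and agents serve the description of the
  system only: the agents never see them.
\<close>

datatype side = Prev | Next

fun opposite :: "side \<Rightarrow> side" where
  "opposite Prev = Next"
| "opposite Next = Prev"

datatype hand = Left | Right

fun neighbour :: "nat \<Rightarrow> nat \<Rightarrow> side \<Rightarrow> nat" where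
  "neighbour n i Next = (i + 1) mod n"
| "neighbour n i Prev = (i + n - 1) mod n"

fun edge_of_port :: "nat \<Rightarrow> nat \<Rightarrow> side \<Rightarrow> nat" where
  "edge_of_port n i Next = i"
| "edge_of_port n i Prev = (i + n - 1) mod n"

text \<open>
  A private orientation is the same at all nodes, so it is determined by the side that the agent
  calls left. The agents are numbered \<open>0, \<dots>, k - 1\<close>.
\<close>

record ring_system =
  num_nodes :: nat
  port_label :: "nat \<Rightarrow> side \<Rightarrow> nat"
  num_agents :: nat
  homebase :: "nat \<Rightarrow> nat"
  left_side :: "nat \<Rightarrow> side"

definition dynamic_ring_system :: "ring_system \<Rightarrow> bool" where
  "dynamic_ring_system X \<longleftrightarrow>
     (\<forall>i < num_nodes X. port_label X i Prev \<noteq> port_label X i Next) \<and>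
     (\<forall>a < num_agents X. homebase X a < num_nodes X) \<and>
     inj_on (homebase X) {..<num_agents X}"

definition has_chirality :: "ring_system \<Rightarrow> bool" where
  "has_chirality X \<longleftrightarrow>
     (\<forall>a < num_agents X. \<forall>b < num_agents X. left_side X a = left_side X b)"

fun port_at :: "side \<Rightarrow> hand \<Rightarrow> side" where
  "port_at l Left = l"
| "port_at l Right = opposite l"

definition hand_of :: "side \<Rightarrow> side \<Rightarrow> hand" where
  "hand_of l s = (if s = l then Left else Right)"

text \<open>The assumptions under which the agents operate.\<close>

record setting =
  chirality :: bool
  cross_detection :: bool
  knows_n :: bool
  knows_k :: bool

definition admissible :: "setting \<Rightarrow> ring_system \<Rightarrow> bool" where
  "admissible E X \<longleftrightarrow> dynamic_ring_system X \<and> (chirality E \<longrightarrow> has_chirality X)"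

text \<open>At most one edge is missing in a round; \<open>None\<close> means that no edge is missing.\<close>

type_synonym schedule = "nat \<Rightarrow> nat option"

definition valid_schedule :: "ring_system \<Rightarrow> schedule \<Rightarrow> bool" where
  "valid_schedule X \<sigma> \<longleftrightarrow> (\<forall>t e. \<sigma> t = Some e \<longrightarrow> e < num_nodes X)"


section \<open>Protocols\<close>

text \<open>
  A place within a node; \<open>'p\<close> is \<open>side\<close> in the description of the system and \<open>hand\<close> in
  the view of an agent.
\<close>

datatype 'p place = At_Node | Incoming 'p | Outgoing 'p

text \<open>
  \<open>others p\<close> counts the other agents of the same node that are in place \<open>p\<close>. The field
  \<open>saw_crossing\<close> reports a crossing in the preceding round.
\<close>

record observation =
  on_homebase :: bool
  label_of :: "hand \<Rightarrow> nat"
  own_place :: "hand place"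
  others :: "hand place \<Rightarrow> nat"
  saw_crossing :: bool

text \<open>
  The knowledge of \<open>n\<close> and \<open>k\<close>, if any, is handed over in the initial memory. In the result of
  \<open>compute\<close>, the direction \<open>nil\<close> is \<open>None\<close>.
\<close>

record ('s, 'm) protocol =
  init_state :: 's
  terminal_state :: 's
  init_memory :: "nat option \<Rightarrow> nat option \<Rightarrow> 'm"
  compute :: "'s \<Rightarrow> 'm \<Rightarrow> observation \<Rightarrow> hand option \<times> 's \<times> 'm"


section \<open>Executions\<close>

record ('s, 'm) agent_conf =
  node :: nat
  place_in :: "side place"
  state :: 's
  memory :: 'm
  crossed :: bool

type_synonym ('s, 'm) conf = "nat \<Rightarrow> ('s, 'm) agent_conf"

definition initial_conf :: "setting \<Rightarrow> ring_system \<Rightarrow> ('s, 'm) protocol \<Rightarrow> ('s, 'm) conf" where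
  "initial_conf E X P a =
     \<lparr> node = homebase X a, place_in = At_Node, state = init_state P,
       memory = init_memory P (if knows_n E then Some (num_nodes X) else None)
                              (if knows_k E then Some (num_agents X) else None),
       crossed = False \<rparr>"

definition observe :: "setting \<Rightarrow> ring_system \<Rightarrow> ('s, 'm) conf \<Rightarrow> nat \<Rightarrow> observation" where
  "observe E X c a =
     (let view = map_place (hand_of (left_side X a)) in
      \<lparr> on_homebase = (node (c a) \<in> homebase X ` {..<num_agents X}),
        label_of = (\<lambda>h. port_label X (node (c a)) (port_at (left_side X a) h)),
        own_place = view (place_in (c a)),
        others = (\<lambda>p. card {b. b < num_agents X \<and> b \<noteq> a \<and> node (c b) = node (c a) \<and>
                              view (place_in (c b)) = p}),
        saw_crossing = (cross_detection E \<and> crossed (c a)) \<rparr>)"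

text \<open>An agent in the terminal state takes no further decisions.\<close>

definition decision ::
  "setting \<Rightarrow> ring_system \<Rightarrow> ('s, 'm) protocol \<Rightarrow> ('s, 'm) conf \<Rightarrow> nat \<Rightarrow> hand option \<times> 's \<times> 'm" where
  "decision E X P c a =
     (if state (c a) = terminal_state P then (None, state (c a), memory (c a))
      else compute P (state (c a)) (memory (c a)) (observe E X c a))"

definition chosen_port ::
  "setting \<Rightarrow> ring_system \<Rightarrow> ('s, 'm) protocol \<Rightarrow> ('s, 'm) conf \<Rightarrow> nat \<Rightarrow> side option" where
  "chosen_port E X P c a = map_option (port_at (left_side X a)) (fst (decision E X P c a))"

definition traverses ::
  "setting \<Rightarrow> ring_system \<Rightarrow> ('s, 'm) protocol \<Rightarrow> nat option \<Rightarrow> ('s, 'm) conf \<Rightarrow>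
     nat \<Rightarrow> side \<Rightarrow> nat \<Rightarrow> bool" where
  "traverses E X P missing c a s e \<longleftrightarrow>
     chosen_port E X P c a = Some s \<and> edge_of_port (num_nodes X) (node (c a)) s = e \<and>
     missing \<noteq> Some e"

definition step ::
  "setting \<Rightarrow> ring_system \<Rightarrow> ('s, 'm) protocol \<Rightarrow> nat option \<Rightarrow> ('s, 'm) conf \<Rightarrow> ('s, 'm) conf" where
  "step E X P missing c a =
     (let (_, st, mem) = decision E X P c a; i = node (c a) in
      case chosen_port E X P c a of
        None \<Rightarrow>
          \<lparr> node = i, place_in = At_Node, state = st, memory = mem, crossed = False \<rparr>
      | Some s \<Rightarrow>
          if missing = Some (edge_of_port (num_nodes X) i s) then
            \<lparr> node = i, place_in = Outgoing s, state = st, memory = mem, crossed = False \<rparr>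
          else
            \<lparr> node = neighbour (num_nodes X) i s, place_in = Incoming (opposite s),
              state = st, memory = mem,
              crossed = (\<exists>b < num_agents X.
                traverses E X P missing c b (opposite s) (edge_of_port (num_nodes X) i s)) \<rparr>)"

primrec run ::
  "setting \<Rightarrow> ring_system \<Rightarrow> ('s, 'm) protocol \<Rightarrow> schedule \<Rightarrow> nat \<Rightarrow> ('s, 'm) conf" where
  "run E X P \<sigma> 0 = initial_conf E X P"
| "run E X P \<sigma> (Suc t) = step E X P (\<sigma> t) (run E X P \<sigma> t)"


section \<open>Strict Gathering\<close>

text \<open>The buffers of a node belong to the node.\<close>

definition strictly_gathered :: "ring_system \<Rightarrow> ('s, 'm) conf \<Rightarrow> bool" where
  "strictly_gathered X c \<longleftrightarrow> (\<exists>v. \<forall>a < num_agents X. node (c a) = v)"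

definition local_view ::
  "setting \<Rightarrow> ring_system \<Rightarrow> ('s, 'm) conf \<Rightarrow> nat \<Rightarrow> 's \<times> 'm \<times> observation" where
  "local_view E X c a = (state (c a), memory (c a), observe E X c a)"

text \<open>
  Awareness is meant in the epistemic sense: strict gathering holds in every situation that the
  agent cannot tell from the actual one, over all executions of the protocol in systems that are
  compatible with its a priori knowledge.
\<close>

definition same_knowledge :: "setting \<Rightarrow> ring_system \<Rightarrow> ring_system \<Rightarrow> bool" where
  "same_knowledge E X Y \<longleftrightarrow>
     (knows_n E \<longrightarrow> num_nodes Y = num_nodes X) \<and> (knows_k E \<longrightarrow> num_agents Y = num_agents X)"

definition aware_of_gathering ::
  "setting \<Rightarrow> ring_system \<Rightarrow> ('s, 'm) protocol \<Rightarrow> ('s, 'm) conf \<Rightarrow> nat \<Rightarrow> bool" where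
  "aware_of_gathering E X P c a \<longleftrightarrow>
     (\<forall>Y \<sigma> t b. admissible E Y \<and> same_knowledge E X Y \<and> valid_schedule Y \<sigma> \<and>
        b < num_agents Y \<and> local_view E Y (run E Y P \<sigma> t) b = local_view E X c a \<longrightarrow>
        strictly_gathered Y (run E Y P \<sigma> t))"

definition solves_strict_gathering ::
  "setting \<Rightarrow> ring_system \<Rightarrow> ('s, 'm) protocol \<Rightarrow> bool" where
  "solves_strict_gathering E X P \<longleftrightarrow>
     (\<forall>\<sigma>. valid_schedule X \<sigma> \<longrightarrow>
        (\<exists>t. let c = run E X P \<sigma> t in
           (\<forall>a < num_agents X. state (c a) = terminal_state P) \<and>
           strictly_gathered X c \<and>
           (\<forall>a < num_agents X. aware_of_gathering E X P c a)))"

end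

(*
  The adversary never lets all agents meet. Suppose that the agents are not all in one node, but
  would all end the round in v if no edge were missing. Then some agent moves from a node u \<noteq> v
  to v; the adversary removes the edge it uses. That agent stays in u, and any other agent that
  now ends in u instead of v was also stopped in u by the missing edge. So the agents could all
  end in u only if they had all been there before.
*)

theory Submission
  imports Defs
begin

text \<open>The choice \<open>chosen_port E X P c a\<close> does not involve \<open>m\<close>, so
  rounds from the same \<open>c\<close> with different missing edges can be compared agent by
  agent.\<close>

lemma node_step:
  "node (step E X P m c a) =
     (case chosen_port E X P c a of
        None \<Rightarrow> node (c a)
      | Some s \<Rightarrow> if m = Some (edge_of_port (num_nodes X) (node (c a)) s) then node (c a)
                  else neighbour (num_nodes X) (node (c a)) s)"
  by (auto simp: step_def Let_def split: option.split prod.split)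

lemma neighbour_less: "i < n \<Longrightarrow> neighbour n i s < n"
  by (cases s) auto

lemma edge_of_port_less: "i < n \<Longrightarrow> edge_of_port n i s < n"
  by (cases s) auto

lemma node_step_less:
  "node (c a) < num_nodes X \<Longrightarrow> node (step E X P m c a) < num_nodes X"
  by (auto simp: node_step neighbour_less split: option.split)

lemma not_strictly_gathered_step:
  assumes nodes: "\<And>a. a < num_agents X \<Longrightarrow> node (c a) < num_nodes X"
    and apart: "\<not> strictly_gathered X c"
  shows "\<exists>m. (\<forall>e. m = Some e \<longrightarrow> e < num_nodes X) \<and> \<not> strictly_gathered X (step E X P m c)"
proof (cases "strictly_gathered X (step E X P None c)")
  case False
  then show ?thesis by (intro exI[of _ None]) simp
next
  case True
  then obtain v where v: "\<And>b. b < num_agents X \<Longrightarrow> node (step E X P None c b) = v"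
    by (auto simp: strictly_gathered_def)
  obtain a where a: "a < num_agents X" "node (c a) \<noteq> v"
    using apart by (auto simp: strictly_gathered_def)
  \<comment> \<open>With no edge missing \<open>a\<close> ends in \<open>v\<close>, away from its
    current node, so it cannot have chosen nil.\<close>
  then obtain s where s: "chosen_port E X P c a = Some s"
    using v[of a] by (auto simp: node_step split: option.splits)
  define e where "e = edge_of_port (num_nodes X) (node (c a)) s"
  have "\<not> strictly_gathered X (step E X P (Some e) c)"
  proof
    assume "strictly_gathered X (step E X P (Some e) c)"
    moreover have "node (step E X P (Some e) c a) = node (c a)"
      by (simp add: node_step s e_def)
    ultimately have u: "node (step E X P (Some e) c b) = node (c a)"
      if "b < num_agents X" for b
      using that a(1) by (metis strictly_gathered_def)
    \<comment> \<open>If \<open>b\<close> chose nil or was blocked, it did not move and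
      \<open>u\<close> is already the claim. If it crossed an edge other than \<open>e\<close>, it
      ends in the same node with or without \<open>e\<close>, so \<open>u\<close> and
      \<open>v\<close> would give \<open>node (c a) = v\<close>.\<close>
    have "node (c b) = node (c a)" if "b < num_agents X" for b
      using u[OF that] v[OF that] a(2) by (auto simp: node_step split: option.splits if_splits)
    then show False using apart by (auto simp: strictly_gathered_def)
  qed
  moreover have "e < num_nodes X"
    unfolding e_def by (rule edge_of_port_less) (rule nodes[OF a(1)])
  ultimately show ?thesis by (intro exI[of _ "Some e"]) simp
qed

text \<open>Iterates the one-round choice of the adversary. Two agents are required because a single
  one is always strictly gathered.\<close>

lemma exists_schedule_never_strictly_gathered:
  assumes X: "dynamic_ring_system X" and k: "2 \<le> num_agents X"
  obtains \<sigma> where "valid_schedule X \<sigma>" and "\<And>t. \<not> strictly_gathered X (run E X P \<sigma> t)"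
proof -
  \<comment> \<open>The bound on the nodes is carried along because it makes the next removed edge a
    legal one.\<close>
  let ?ok = "\<lambda>c. (\<forall>a < num_agents X. node (c a) < num_nodes X) \<and> \<not> strictly_gathered X c"
  let ?move = "\<lambda>m c c'. (\<forall>e. m = Some e \<longrightarrow> e < num_nodes X) \<and> c' = step E X P m c"
  have "\<not> strictly_gathered X (initial_conf E X P)"
  proof
    assume "strictly_gathered X (initial_conf E X P)"
    then have "homebase X 0 = homebase X 1"
      using k by (auto simp: strictly_gathered_def initial_conf_def)
    then show False
      using X k by (auto simp: dynamic_ring_system_def dest: inj_onD)
  qed
  then have init: "?ok (initial_conf E X P)"
    using X by (simp add: dynamic_ring_system_def initial_conf_def)
  have next_conf: "\<exists>c'. ?ok c' \<and> (\<exists>m. ?move m c c')" if c: "?ok c" for c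
  proof -
    obtain m where m: "\<forall>e. m = Some e \<longrightarrow> e < num_nodes X"
      and apart: "\<not> strictly_gathered X (step E X P m c)"
      using not_strictly_gathered_step[of X c E P] c by blast
    have "?ok (step E X P m c)"
      using c apart by (simp add: node_step_less)
    moreover have "?move m c (step E X P m c)"
      using m by simp
    ultimately show ?thesis by blast
  qed
  \<comment> \<open>Dependent choice yields the configurations first; the clause for
    \<open>t = 0\<close> pins the start. The missing edges are chosen afterwards from
    \<open>ex\<close>.\<close>
  have "\<exists>f. \<forall>t. (?ok (f t) \<and> (t = 0 \<longrightarrow> f t = initial_conf E X P)) \<and>
              (\<exists>m. ?move m (f t) (f (Suc t)))"
  proof (rule dependent_nat_choice)
    show "\<exists>c. ?ok c \<and> (0 = (0::nat) \<longrightarrow> c = initial_conf E X P)"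
      using init by blast
  next
    fix c and t :: nat
    assume "?ok c \<and> (t = 0 \<longrightarrow> c = initial_conf E X P)"
    then obtain c' where "?ok c'" "\<exists>m. ?move m c c'"
      using next_conf[of c] by blast
    then show "\<exists>c'. (?ok c' \<and> (Suc t = 0 \<longrightarrow> c' = initial_conf E X P)) \<and> (\<exists>m. ?move m c c')"
      by blast
  qed
  then obtain f where f: "f 0 = initial_conf E X P" "\<And>t. ?ok (f t)"
    and ex: "\<forall>t. \<exists>m. ?move m (f t) (f (Suc t))"
    by blast
  obtain \<sigma> where \<sigma>: "\<And>t. ?move (\<sigma> t) (f t) (f (Suc t))"
    using choice[OF ex] by blast
  have run: "run E X P \<sigma> t = f t" for t
    by (induction t) (use f(1) \<sigma> in simp_all)
  show ?thesis
  proof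
    show "valid_schedule X \<sigma>" using \<sigma> by (simp add: valid_schedule_def)
    show "\<not> strictly_gathered X (run E X P \<sigma> t)" for t using f(2) by (simp add: run)
  qed
qed

theorem mainTheorem7:
  fixes E :: setting and X :: ring_system
  assumes "admissible E X"
    and "2 \<le> num_agents X"
  shows "\<not> (\<exists>P :: ('s, 'm) protocol. solves_strict_gathering E X P)"
proof
  assume "\<exists>P :: ('s, 'm) protocol. solves_strict_gathering E X P"
  then obtain P :: "('s, 'm) protocol" where P: "solves_strict_gathering E X P" by blast
  have "dynamic_ring_system X" using assms(1) by (simp add: admissible_def)
  \<comment> \<open>The schedule may be tailored to \<open>P\<close>, since a solution must succeed
    under every valid schedule.\<close>
  then obtain \<sigma> where "valid_schedule X \<sigma>" "\<And>t. \<not> strictly_gathered X (run E X P \<sigma> t)"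
    using exists_schedule_never_strictly_gathered[OF _ assms(2)] by blast
  with P show False by (auto simp: solves_strict_gathering_def Let_def)
qed

end
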